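(* Let $\psi$ be a surjective map from a topological space $Y$ to a set $X$, and define $h:X\to Y/R(\psi)$ by $h(x)=\psi^{-1}(x)$. (a) The function $h$ is a bijection, and $h\circ\psi$ is the quotient map $q:Y\to Y/R(\psi)$. (b) If $X$ is a topological space and $\psi$ is continuous, then $h$ is open. (c) Suppose that $X$ is a topological space and $\psi:Y\to X$ is a quotient map, in the sense that $U$ is open in $X$ if and only if $\psi^{-1}(U)$ is open in $Y$. Then $h$ is a homeomorphism of $X$ onto $Y/R(\psi)$.
   Context: $R(\psi)=\{(y,z)\in Y\times Y:\psi(y)=\psi(z)\}$ is regarded as a topological groupoid (an equivalence relation on $Y$) with unit space $Y$, with $r(y,z)=y$, $s(y,z)=z$, $(x,y)(y,z)=(x,z)$. The orbit of $y\in Y$ is $r(s^{-1}(y))=\{z\in Y:\psi(z)=\psi(y)\}$. $Y/R(\psi)$ denotes the orbit space, i.e. the set of orbits (equivalence classes) with the quotient topology, and $q:Y\to Y/R(\psi)$ takes a point to its orbit. *)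

theory Defs
  imports "HOL-Analysis.Analysis"
begin

definition quotient_topology :: "'a topology \<Rightarrow> ('a \<Rightarrow> 'b) \<Rightarrow> 'b topology" where
  "quotient_topology Y f =
     topology (\<lambda>U. U \<subseteq> f ` topspace Y \<and> openin Y {y \<in> topspace Y. f y \<in> U})"

text \<open>The function \<^const>\<open>topology\<close> is only meaningful on predicates satisfying
  \<^const>\<open>istopology\<close>; the following facts show that the definition above is sound.\<close>

lemma openin_quotient_topology:
  "openin (quotient_topology Y f) U \<longleftrightarrow>
     U \<subseteq> f ` topspace Y \<and> openin Y {y \<in> topspace Y. f y \<in> U}"
proof -
  let ?L = "\<lambda>U. U \<subseteq> f ` topspace Y \<and> openin Y {y \<in> topspace Y. f y \<in> U}"
  have "istopology ?L"
    unfolding istopology_def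
  proof (intro conjI allI impI)
    fix S T assume S: "?L S" and T: "?L T"
    then show "S \<inter> T \<subseteq> f ` topspace Y" by blast
    have "{y \<in> topspace Y. f y \<in> S \<inter> T} = {y \<in> topspace Y. f y \<in> S} \<inter> {y \<in> topspace Y. f y \<in> T}"
      by blast
    with S T show "openin Y {y \<in> topspace Y. f y \<in> S \<inter> T}" by (simp add: openin_Int)
  next
    fix \<K> assume K: "\<forall>K\<in>\<K>. ?L K"
    then show "\<Union>\<K> \<subseteq> f ` topspace Y" by blast
    have "{y \<in> topspace Y. f y \<in> \<Union>\<K>} = (\<Union>K\<in>\<K>. {y \<in> topspace Y. f y \<in> K})"
      by blast
    moreover have "openin Y (\<Union>K\<in>\<K>. {y \<in> topspace Y. f y \<in> K})"
      using K by (intro openin_Union) blast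
    ultimately show "openin Y {y \<in> topspace Y. f y \<in> \<Union>\<K>}" by (rule ssubst)
  qed
  then show ?thesis
    unfolding quotient_topology_def by (subst topology_inverse') (rule refl | assumption)+
qed

lemma topspace_quotient_topology: "topspace (quotient_topology Y f) = f ` topspace Y"
proof
  show "topspace (quotient_topology Y f) \<subseteq> f ` topspace Y"
    using openin_topspace[of "quotient_topology Y f"] unfolding openin_quotient_topology by (rule conjunct1)
  have "{y \<in> topspace Y. f y \<in> f ` topspace Y} = topspace Y" by blast
  then have "openin (quotient_topology Y f) (f ` topspace Y)"
    by (simp add: openin_quotient_topology)
  then show "f ` topspace Y \<subseteq> topspace (quotient_topology Y f)"
    by (rule openin_subset)
qed

lemma quotient_map_quotient_topology: "quotient_map Y (quotient_topology Y f) f"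
  unfolding quotient_map_def topspace_quotient_topology openin_quotient_topology by blast

definition kernel_groupoid :: "'a topology \<Rightarrow> ('a \<Rightarrow> 'b) \<Rightarrow> ('a \<times> 'a) set" where
  "kernel_groupoid Y \<psi> = {(y, z). y \<in> topspace Y \<and> z \<in> topspace Y \<and> \<psi> y = \<psi> z}"

text \<open>An equivalence relation \<open>R\<close> on \<open>Y\<close> is regarded as a groupoid with unit space \<open>Y\<close>,
  range map \<open>(y, z) \<mapsto> y\<close> and source map \<open>(y, z) \<mapsto> z\<close>. Its orbits depend on neither the
  composition nor the topology of \<open>R\<close>, so those are not recorded.\<close>

definition range_map :: "'a \<times> 'a \<Rightarrow> 'a" where
  "range_map = fst"

definition source_map :: "'a \<times> 'a \<Rightarrow> 'a" where
  "source_map = snd"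

definition orbit :: "('a \<times> 'a) set \<Rightarrow> 'a \<Rightarrow> 'a set" where
  "orbit R y = range_map ` {g \<in> R. source_map g = y}"

definition orbit_space :: "'a topology \<Rightarrow> ('a \<times> 'a) set \<Rightarrow> 'a set topology" where
  "orbit_space Y R = quotient_topology Y (orbit R)"

lemma orbit_kernel_groupoid:
  assumes "y \<in> topspace Y"
  shows "orbit (kernel_groupoid Y \<psi>) y = {z \<in> topspace Y. \<psi> z = \<psi> y}"
  using assms unfolding orbit_def kernel_groupoid_def range_map_def source_map_def image_def
  by simp

definition fibre :: "'a topology \<Rightarrow> ('a \<Rightarrow> 'b) \<Rightarrow> 'b \<Rightarrow> 'a set" where
  "fibre Y \<psi> x = {y \<in> topspace Y. \<psi> y = x}"

end

theory Submission
  imports Defs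
begin

text \<open>The orbits of the kernel groupoid are the nonempty fibres of \<open>\<psi>\<close>, so
  \<open>fibre Y \<psi> \<circ> \<psi>\<close> is the orbit map \<open>q\<close>. A nonempty fibre determines the point below it,
  whence bijectivity. Injectivity also gives \<open>q\<^sup>-\<^sup>1(h(U)) = \<psi>\<^sup>-\<^sup>1(U)\<close> for \<open>U \<subseteq> X\<close>, and this
  identity translates continuity of \<open>\<psi>\<close> into openness of \<open>h\<close>. If \<open>\<psi>\<close> is moreover a quotient
  map, then \<open>h\<close> is continuous because \<open>h \<circ> \<psi> = q\<close> is, so the open bijection \<open>h\<close> is a
  homeomorphism.\<close>

lemma fibre_image_eq_orbit:
  assumes "y \<in> topspace Y"
  shows "fibre Y \<psi> (\<psi> y) = orbit (kernel_groupoid Y \<psi>) y"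
  using assms by (simp add: orbit_kernel_groupoid fibre_def)

text \<open>Over the image of \<open>\<psi>\<close> fibres are nonempty, and any element \<open>y\<close> of a fibre recovers its
  base point as \<open>\<psi> y\<close>. Off the image all fibres are empty, hence the restriction to the
  image.\<close>

lemma inj_on_fibre: "inj_on (fibre Y \<psi>) (\<psi> ` topspace Y)"
  by (rule inj_onI) (auto simp: fibre_def)

lemma topspace_orbit_space_kernel_groupoid:
  "topspace (orbit_space Y (kernel_groupoid Y \<psi>)) = fibre Y \<psi> ` \<psi> ` topspace Y"
  unfolding orbit_space_def topspace_quotient_topology image_image
  by (rule image_cong) (simp_all add: fibre_image_eq_orbit)

lemma quotient_map_orbit: "quotient_map Y (orbit_space Y R) (orbit R)"
  unfolding orbit_space_def by (rule quotient_map_quotient_topology)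

text \<open>Openness in the orbit space is tested on preimages under the orbit map, and the preimage
  of \<open>fibre Y \<psi> ` U\<close> is \<open>\<psi>\<^sup>-\<^sup>1(U)\<close>: an orbit that is the fibre over a point of \<open>U\<close> is the fibre
  over no other point.\<close>

lemma open_map_fibre:
  assumes surj: "\<psi> ` topspace Y = topspace T" and cont: "continuous_map Y T \<psi>"
  shows "open_map T (orbit_space Y (kernel_groupoid Y \<psi>)) (fibre Y \<psi>)"
  unfolding open_map_def
proof (intro allI impI)
  fix U assume U: "openin T U"
  let ?q = "orbit (kernel_groupoid Y \<psi>)"
  have sub: "U \<subseteq> \<psi> ` topspace Y"
    using openin_subset[OF U] surj by simp
  have "{y \<in> topspace Y. ?q y \<in> fibre Y \<psi> ` U} = {y \<in> topspace Y. \<psi> y \<in> U}"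
    by (rule Collect_cong)
      (simp add: inj_on_image_mem_iff[OF inj_on_fibre _ sub] flip: fibre_image_eq_orbit
        cong: conj_cong)
  with U cont have "openin Y {y \<in> topspace Y. ?q y \<in> fibre Y \<psi> ` U}"
    by (simp add: openin_continuous_map_preimage)
  moreover have "fibre Y \<psi> ` U \<subseteq> ?q ` topspace Y"
    using sub by (auto simp: fibre_image_eq_orbit)
  ultimately show "openin (orbit_space Y (kernel_groupoid Y \<psi>)) (fibre Y \<psi> ` U)"
    by (simp add: orbit_space_def openin_quotient_topology)
qed

text \<open>Universal property of the quotient map \<open>\<psi>\<close>: continuity may be checked after composing
  with \<open>\<psi>\<close>, which turns \<open>fibre Y \<psi>\<close> into the orbit map.\<close>

lemma continuous_map_fibre:
  assumes "quotient_map Y T \<psi>"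
  shows "continuous_map T (orbit_space Y (kernel_groupoid Y \<psi>)) (fibre Y \<psi>)"
proof (rule continuous_compose_quotient_map[OF assms])
  show "continuous_map Y (orbit_space Y (kernel_groupoid Y \<psi>)) (fibre Y \<psi> \<circ> \<psi>)"
    by (rule continuous_map_eq[OF quotient_imp_continuous_map[OF quotient_map_orbit]])
      (simp add: fibre_image_eq_orbit)
qed

theorem lemma4p1:
  fixes Y :: "'a topology" and X :: "'b set" and \<psi> :: "'a \<Rightarrow> 'b"
  assumes surj: "\<psi> ` topspace Y = X"
  defines "h \<equiv> fibre Y \<psi>"
    and "q \<equiv> orbit (kernel_groupoid Y \<psi>)"
    and "YR \<equiv> orbit_space Y (kernel_groupoid Y \<psi>)"
  shows "(bij_betw h X (topspace YR) \<and> (\<forall>y \<in> topspace Y. (h \<circ> \<psi>) y = q y))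
    \<and> (\<forall>T. topspace T = X \<and> continuous_map Y T \<psi> \<longrightarrow> open_map T YR h)
    \<and> (\<forall>T. topspace T = X \<and> quotient_map Y T \<psi> \<longrightarrow> homeomorphic_map T YR h)"
proof -
  have inj: "inj_on h X" and img: "h ` X = topspace YR"
    using inj_on_fibre[of Y \<psi>] topspace_orbit_space_kernel_groupoid[of Y \<psi>]
    by (simp_all add: h_def YR_def surj)
  then have "bij_betw h X (topspace YR)"
    by (simp add: bij_betw_def)
  moreover have "\<forall>y \<in> topspace Y. (h \<circ> \<psi>) y = q y"
    by (simp add: h_def q_def fibre_image_eq_orbit)
  moreover have op: "open_map T YR h" if "topspace T = X" "continuous_map Y T \<psi>" for T
    using open_map_fibre[of \<psi> Y T] that surj by (simp add: h_def YR_def)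
  moreover have "homeomorphic_map T YR h" if T: "topspace T = X" "quotient_map Y T \<psi>" for T
  proof (rule bijective_open_imp_homeomorphic_map)
    show "continuous_map T YR h"
      unfolding h_def YR_def using T(2) by (rule continuous_map_fibre)
    show "open_map T YR h"
      using op T quotient_imp_continuous_map by blast
  qed (use inj img T in simp_all)
  ultimately show ?thesis by blast
qed

end
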